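(* Let $\langle\chi,\vec a\rangle$ be a loop, $\check\phi$ a quantifier-free formula over $\vec x$, and $\mathit{mf}:\mathbb Z^d\to\mathbb Q$ a function such that \[ \check\phi(\vec x)\land\chi(\vec x)\implies\mathit{mf}(\vec x)-\mathit{mf}(\vec a(\vec x))\le 1 \qquad\text{and}\qquad \check\phi(\vec x)\land\neg\chi(\vec x)\implies\mathit{mf}(\vec x)\le 0 \] hold for all $\vec x\in\mathbb Z^d$. Then the conditional acceleration technique mapping $(\langle\chi,\vec a\rangle,\check\phi)$ to \[ \vec x'=\vec a^n(\vec x)\land n<\mathit{mf}(\vec x)+1 \] is sound; i.e., for all $\vec x,\vec x'\in\mathbb Z^d$ and $n>0$, if $\vec x\longrightarrow^n_{\langle\check\phi,\vec a\rangle}\vec x'$ and $\vec x'=\vec a^n(\vec x)\land n<\mathit{mf}(\vec x)+1$, then $\vec x\longrightarrow^n_{\langle\chi,\vec a\rangle}\vec x'$.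
   Context: Fix $d\ge 1$, integer variables $\vec x=(x_1,\dots,x_d)$, $\vec x'$, and $n$ ranging over $\mathbb N$. A loop $\langle\chi,\vec a\rangle$ consists of a quantifier-free formula $\chi$ over atoms $p>0$ ($p$ an arithmetic expression over $\vec x$, integer semantics) and a map $\vec a:\mathbb Z^d\to\mathbb Z^d$ given by expressions over $\vec x$; $\vec a^m$ is $m$-fold application. $\vec x\longrightarrow_{\langle\chi,\vec a\rangle}\vec x'$ iff $\chi(\vec x)\land\vec x'=\vec a(\vec x)$, and $\longrightarrow^m$ is its $m$-fold composition; thus $\vec x\longrightarrow^m_{\langle\chi,\vec a\rangle}\vec x'$ iff $\vec x'=\vec a^m(\vec x)$ and $\chi(\vec a^i(\vec x))$ for all $0\le i<m$. *)

theory Defs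
  imports "HOL-Analysis.Finite_Cartesian_Product"
begin

datatype 'd expr =
    Var 'd
  | Const int
  | Add "'d expr" "'d expr"
  | Sub "'d expr" "'d expr"
  | Mul "'d expr" "'d expr"
  | Div "'d expr" "'d expr"
  | Pow "'d expr" "'d expr"

text \<open>Division and exponentiation are totalised: quotients are rounded down, division by zero
  yields zero, and negative exponents are treated as zero.\<close>

primrec eval :: "'d::finite expr \<Rightarrow> int ^ 'd \<Rightarrow> int" where
  "eval (Var i) x = x $ i"
| "eval (Const c) x = c"
| "eval (Add p q) x = eval p x + eval q x"
| "eval (Sub p q) x = eval p x - eval q x"
| "eval (Mul p q) x = eval p x * eval q x"
| "eval (Div p q) x = eval p x div eval q x"
| "eval (Pow p q) x = eval p x ^ nat (eval q x)"

datatype 'd qf =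
    Pos "'d expr"
  | Neg "'d qf"
  | Conj "'d qf" "'d qf"
  | Disj "'d qf" "'d qf"

primrec sat :: "'d::finite qf \<Rightarrow> int ^ 'd \<Rightarrow> bool" where
  "sat (Pos p) x \<longleftrightarrow> eval p x > 0"
| "sat (Neg f) x \<longleftrightarrow> \<not> sat f x"
| "sat (Conj f g) x \<longleftrightarrow> sat f x \<and> sat g x"
| "sat (Disj f g) x \<longleftrightarrow> sat f x \<or> sat g x"

type_synonym 'd loop = "'d qf \<times> ('d expr ^ 'd)"

definition update :: "'d expr ^ 'd \<Rightarrow> int ^ 'd \<Rightarrow> int ^ 'd::finite" where
  "update a x = (\<chi> i. eval (a $ i) x)"

definition step :: "'d::finite loop \<Rightarrow> int ^ 'd \<Rightarrow> int ^ 'd \<Rightarrow> bool" where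
  "step L x x' \<longleftrightarrow> sat (fst L) x \<and> x' = update (snd L) x"

text \<open>A conditional acceleration technique is a partial map on pairs of a loop and a formula. Its
  results are predicates over the initial values, the number of iterations and the final values,
  rather than syntactic formulas, because they may involve functions (such as metering functions)
  that are not given by expressions.\<close>

type_synonym 'd cond_accel =
  "'d loop \<times> 'd qf \<rightharpoonup> (int ^ 'd \<Rightarrow> nat \<Rightarrow> int ^ 'd \<Rightarrow> bool)"

definition sound_cond_accel :: "'d::finite cond_accel \<Rightarrow> bool" where
  "sound_cond_accel accel \<longleftrightarrow>
    (\<forall>chi a phi psi. accel ((chi, a), phi) = Some psi \<longrightarrow>
      (\<forall>x x' n. n > 0 \<longrightarrow> (step (phi, a) ^^ n) x x' \<longrightarrow> psi x n x' \<longrightarrow> (step (chi, a) ^^ n) x x'))"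

end

theory Submission imports Defs begin

text \<open>While \<open>phi\<close> and \<open>chi\<close> hold, \<open>mf\<close> drops by at most
  1 per iteration, so a value above n - 1 leaves \<open>mf\<close> positive before each of the next
  n iterations. By the contrapositive of the second hypothesis, a positive \<open>mf\<close> under
  \<open>phi\<close> forces \<open>chi\<close>. Hence each step of the \<open>phi\<close>-run is
  also a \<open>chi\<close>-step.\<close>

lemma metering_step_relpowp:
  fixes chi phi :: "'d::finite qf"
    and a :: "'d expr ^ 'd"
    and mf :: "int ^ 'd \<Rightarrow> rat"
  assumes decr: "\<And>x. sat phi x \<and> sat chi x \<Longrightarrow> mf x - mf (update a x) \<le> 1"
    and nonpos: "\<And>x. sat phi x \<and> \<not> sat chi x \<Longrightarrow> mf x \<le> 0"
    and "(step (phi, a) ^^ n) x x'"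
    and "of_nat n < mf x + 1"
  shows "(step (chi, a) ^^ n) x x'"
  using assms(3,4)
proof (induction n arbitrary: x)
  case 0
  then show ?case by simp
next
  case (Suc n)
  \<comment> \<open>The first step is split off, not the last, since the bound concerns
    \<open>mf\<close> at the start of the run.\<close>
  from relpowp_Suc_D2[OF Suc.prems(1)]
  have phi: "sat phi x" and run: "(step (phi, a) ^^ n) (update a x) x'"
    by (auto simp: step_def[of _ x])
  have mf: "of_nat n < mf x"
    using Suc.prems(2) by simp
  then have "\<not> mf x \<le> 0"
    using of_nat_0_le_iff[of n, where ?'a = rat] by linarith
  then have chi: "sat chi x"
    using nonpos phi by blast
  \<comment> \<open>One iteration costs at most 1, which matches the one step fewer still to run:
    the bound is an invariant.\<close>
  then have "of_nat n < mf (update a x) + 1"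
    using decr[of x] phi mf by linarith
  then have "(step (chi, a) ^^ n) (update a x) x'"
    using Suc.IH run by blast
  moreover have "step (chi, a) x (update a x)"
    using chi by (simp add: step_def)
  ultimately show ?case
    by (rule relpowp_Suc_I2[rotated])
qed

theorem theorem9:
  fixes chi phi :: "'d::finite qf"
    and a :: "'d expr ^ 'd"
    and mf :: "int ^ 'd \<Rightarrow> rat"
  assumes "\<And>x. sat phi x \<and> sat chi x \<Longrightarrow> mf x - mf (update a x) \<le> 1"
    and "\<And>x. sat phi x \<and> \<not> sat chi x \<Longrightarrow> mf x \<le> 0"
  shows "sound_cond_accel
    [((chi, a), phi) \<mapsto> (\<lambda>x n x'. x' = (update a ^^ n) x \<and> of_nat n < mf x + 1)]"
  unfolding sound_cond_accel_def
  using metering_step_relpowp[where mf = mf, OF assms]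
  \<comment> \<open>The map is defined at a single argument, so only the given loop and formula
    remain.\<close>
  by (auto split: if_splits)

end
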